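(* Let $K$ be a simplicial complex on $[m]$ and $(\underline X,\underline A)=\{(X_k,A_k)\}_{k=1}^m$ a sequence of topological pairs. Let $K^\circ$ be the Alexander dual of $K$ relative to $[m]$ and $(\underline X,\underline A^c)=\{(X_k,A_k^c)\}_{k=1}^m$ with $A_k^c=X_k\setminus A_k$. Then $$(X_1\times\cdots\times X_m)\setminus\mathcal Z(K;\underline X,\underline A)=\mathcal Z(K^\circ;\underline X,\underline A^c).$$
   Context: $[m]=\{1,\dots,m\}$, $m\ge1$. A simplicial complex $K$ on $[m]$ is a set of subsets of $[m]$ closed under taking subsets; $\{i\}\in K$ is not required; the void complex $\{\,\}$ (no simplices) and $\{\emptyset\}$ are allowed. The Alexander dual relative to $[m]$ is $K^\circ=\{[m]\setminus\sigma:\sigma\subset[m],\ \sigma\notin K\}$. The polyhedral product space is $\mathcal Z(K;\underline X,\underline A)=\bigcup_{\tau\in K}Y_1\times\cdots\times Y_m\subset X_1\times\cdots\times X_m$, with $Y_k=X_k$ if $k\in\tau$ and $Y_k=A_k$ if $k\notin\tau$; it is $\emptyset$ if $K=\{\,\}$. Empty spaces are allowed, with $\emptyset\times Z=\emptyset$. *)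

theory Defs
  imports "HOL-Analysis.Analysis"
begin

text \<open>Vertices need not be simplices, and both the void complex \<open>{}\<close> and \<open>{{}}\<close> are complexes.\<close>

definition simplicial_complex_on :: "nat \<Rightarrow> nat set set \<Rightarrow> bool" where
  "simplicial_complex_on m K \<longleftrightarrow>
     K \<subseteq> Pow {1..m} \<and> (\<forall>\<sigma>\<in>K. \<forall>\<tau>. \<tau> \<subseteq> \<sigma> \<longrightarrow> \<tau> \<in> K)"

definition alexander_dual :: "nat \<Rightarrow> nat set set \<Rightarrow> nat set set" where
  "alexander_dual m K = {{1..m} - \<sigma> | \<sigma>. \<sigma> \<subseteq> {1..m} \<and> \<sigma> \<notin> K}"

lemma simplicial_complex_on_alexander_dual:
  assumes "simplicial_complex_on m K"
  shows "simplicial_complex_on m (alexander_dual m K)"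
  unfolding simplicial_complex_on_def
proof (intro conjI ballI allI impI)
  show "alexander_dual m K \<subseteq> Pow {1..m}"
    by (auto simp: alexander_dual_def)
next
  fix \<rho> \<tau>
  assume "\<rho> \<in> alexander_dual m K" and sub: "\<tau> \<subseteq> \<rho>"
  then obtain \<sigma> where \<sigma>: "\<sigma> \<subseteq> {1..m}" "\<sigma> \<notin> K" "\<rho> = {1..m} - \<sigma>"
    by (auto simp: alexander_dual_def)
  have "\<sigma> \<subseteq> {1..m} - \<tau>"
    using sub \<sigma> by blast
  then have "{1..m} - \<tau> \<notin> K"
    using assms \<sigma>(2) unfolding simplicial_complex_on_def by blast
  moreover have "\<tau> = {1..m} - ({1..m} - \<tau>)"
    using sub \<sigma>(3) by blast
  ultimately show "\<tau> \<in> alexander_dual m K"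
    unfolding alexander_dual_def by blast
qed

definition topological_pair :: "'a topology \<Rightarrow> 'a set \<Rightarrow> bool" where
  "topological_pair X A \<longleftrightarrow> A \<subseteq> topspace X"

text \<open>
  A point of \<open>X\<^sub>1 \<times> \<dots> \<times> X\<^sub>m\<close> is an extensional function on \<open>{1..m}\<close>, as in
  \<^const>\<open>product_topology\<close>. The polyhedral product carries the subspace topology.
  Only the values of \<open>X\<close> and \<open>A\<close> at \<open>1, \<dots>, m\<close> matter.
\<close>

definition polyhedral_product ::
    "nat \<Rightarrow> nat set set \<Rightarrow> (nat \<Rightarrow> 'a topology) \<Rightarrow> (nat \<Rightarrow> 'a set) \<Rightarrow> (nat \<Rightarrow> 'a) topology" where
  "polyhedral_product m K X A =
     subtopology (product_topology X {1..m})
       (\<Union>\<tau>\<in>K. \<Pi>\<^sub>E k\<in>{1..m}. if k \<in> \<tau> then topspace (X k) else A k)"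

end

theory Submission
  imports Defs
begin

text \<open>
  Each point \<open>x\<close> of the product determines one subset of \<open>{1..m}\<close>: the support
  \<open>\<omega>(x)\<close>, consisting of the coordinates \<open>k\<close> at which \<open>x k\<close> lies outside \<open>A k\<close>. A box
  belonging to a simplex \<open>\<tau>\<close> contains \<open>x\<close> exactly when \<open>\<omega>(x) \<subseteq> \<tau>\<close>; as \<open>K\<close> is closed under
  subsets, \<open>x\<close> lies in the polyhedral product of \<open>K\<close> iff \<open>\<omega>(x) \<in> K\<close>
  (\<open>in_topspace_polyhedral_product_iff\<close>).

  Replacing every \<open>A k\<close> by its complement replaces \<open>\<omega>(x)\<close> by \<open>{1..m} - \<omega>(x)\<close>, and this set
  is a simplex of the Alexander dual iff \<open>\<omega>(x) \<notin> K\<close> (\<open>compl_in_alexander_dual_iff\<close>). So the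
  polyhedral product of the dual consists of exactly the points that the one of \<open>K\<close> omits.
\<close>

lemma topspace_polyhedral_product_subset:
  "topspace (polyhedral_product m K X A) \<subseteq> topspace (product_topology X {1..m})"
  by (simp add: polyhedral_product_def)

text \<open>
  A subspace topology is determined by its underlying set, so the equality of spaces below
  reduces to an equality of sets.
\<close>

lemma subtopology_topspace_polyhedral_product:
  "subtopology (product_topology X {1..m}) (topspace (polyhedral_product m K X A))
     = polyhedral_product m K X A"
  unfolding polyhedral_product_def topspace_subtopology
  by (rule subtopology_restrict)

text \<open>
  Among all simplices whose box contains \<open>x\<close>, the support of \<open>x\<close> is the smallest, so the union
  over the whole complex can be tested on this simplex alone.
\<close>

lemma in_topspace_polyhedral_product_iff:
  assumes "simplicial_complex_on m K"
  shows "x \<in> topspace (polyhedral_product m K X A) \<longleftrightarrow>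
           x \<in> topspace (product_topology X {1..m}) \<and> {k \<in> {1..m}. x k \<notin> A k} \<in> K"
    (is "_ \<longleftrightarrow> ?prod \<and> ?\<omega> \<in> K")
proof
  assume "x \<in> topspace (polyhedral_product m K X A)"
  then obtain \<tau> where "\<tau> \<in> K" and prod: ?prod
    and box: "x \<in> (\<Pi>\<^sub>E k\<in>{1..m}. if k \<in> \<tau> then topspace (X k) else A k)"
    unfolding polyhedral_product_def by auto
  have "?\<omega> \<subseteq> \<tau>"
  proof
    fix k
    assume k: "k \<in> ?\<omega>"
    then have "x k \<in> (if k \<in> \<tau> then topspace (X k) else A k)"
      using PiE_mem [OF box] by blast
    with k show "k \<in> \<tau>"
      by (auto split: if_splits)
  qed
  with \<open>\<tau> \<in> K\<close> prod assms show "?prod \<and> ?\<omega> \<in> K"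
    unfolding simplicial_complex_on_def by blast
next
  assume *: "?prod \<and> ?\<omega> \<in> K"
  then have "x \<in> (\<Pi>\<^sub>E k\<in>{1..m}. if k \<in> ?\<omega> then topspace (X k) else A k)"
    by (auto simp: PiE_iff)
  with * show "x \<in> topspace (polyhedral_product m K X A)"
    unfolding polyhedral_product_def topspace_subtopology by blast
qed

lemma compl_in_alexander_dual_iff:
  assumes "\<sigma> \<subseteq> {1..m}"
  shows "{1..m} - \<sigma> \<in> alexander_dual m K \<longleftrightarrow> \<sigma> \<notin> K"
proof
  assume "{1..m} - \<sigma> \<in> alexander_dual m K"
  then obtain \<rho> where "\<rho> \<subseteq> {1..m}" "\<rho> \<notin> K" "{1..m} - \<sigma> = {1..m} - \<rho>"
    unfolding alexander_dual_def by blast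
  moreover from this assms have "\<sigma> = \<rho>"
    by blast
  ultimately show "\<sigma> \<notin> K"
    by simp
qed (use assms in \<open>auto simp: alexander_dual_def\<close>)

theorem theorem5p2:
  fixes m :: nat
    and K :: "nat set set"
    and X :: "nat \<Rightarrow> 'a topology"
    and A :: "nat \<Rightarrow> 'a set"
  assumes "1 \<le> m"
    and "simplicial_complex_on m K"
    and "\<And>k. k \<in> {1..m} \<Longrightarrow> topological_pair (X k) (A k)"
  shows "(topspace (product_topology X {1..m}) - topspace (polyhedral_product m K X A)
           = topspace (polyhedral_product m (alexander_dual m K) X (\<lambda>k. topspace (X k) - A k)))
       \<and> (subtopology (product_topology X {1..m})
           (topspace (product_topology X {1..m}) - topspace (polyhedral_product m K X A))
           = polyhedral_product m (alexander_dual m K) X (\<lambda>k. topspace (X k) - A k))"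
proof -
  let ?P = "product_topology X {1..m}"
  let ?Z = "polyhedral_product m K X A"
  let ?Z' = "polyhedral_product m (alexander_dual m K) X (\<lambda>k. topspace (X k) - A k)"
  have "x \<in> topspace ?Z' \<longleftrightarrow> x \<notin> topspace ?Z" if x: "x \<in> topspace ?P" for x
  proof -
    have "{k \<in> {1..m}. x k \<notin> topspace (X k) - A k} = {1..m} - {k \<in> {1..m}. x k \<notin> A k}"
      using x by (auto simp: PiE_iff)
    moreover have "{1..m} - {k \<in> {1..m}. x k \<notin> A k} \<in> alexander_dual m K
        \<longleftrightarrow> {k \<in> {1..m}. x k \<notin> A k} \<notin> K"
      by (rule compl_in_alexander_dual_iff) blast
    ultimately show ?thesis
      using x by (simp only: simp_thms in_topspace_polyhedral_product_iff assms(2)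
          simplicial_complex_on_alexander_dual)
  qed
  then have compl: "topspace ?P - topspace ?Z = topspace ?Z'"
    using topspace_polyhedral_product_subset [of m "alexander_dual m K" X
        "\<lambda>k. topspace (X k) - A k"] by blast
  then show ?thesis
    by (simp only: subtopology_topspace_polyhedral_product simp_thms)
qed

end
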